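(* Let $(X,Y,M,D)$ be jointly distributed with $(X,Y)$ and $M$ conditionally independent given $D$. Let $$ \widetilde{\gamma}(x,d):=\max_k\mathbb{P}(Y=k\mid X=x,D=d)-\operatorname{2nd}\max_k\mathbb{P}(Y=k\mid X=x,D=d). $$ Then $$ \mathbb{E}_{X,D,M}\left[\widetilde{\gamma}(X,D)\,\mathbf{1}\{f^*_{\mathrm{full}}(X,D)\neq f^*_{\mathrm{DI}}(X,M)\}\right]\;\le\;R^*_{\mathrm{DI}}-R^*_{\mathrm{full}}\;\le\;\mathbb{E}_{X,D,M}\left[\mathbf{1}\{f^*_{\mathrm{full}}(X,D)\neq f^*_{\mathrm{DI}}(X,M)\}\right]. $$
   Context: Setting: $(X,Y,M,D)$ are jointly distributed random variables with law $P_{XYMD}$ and values in measurable spaces $\mathcal{X},\mathcal{Y},\mathcal{M},\mathcal{D}$, where $\mathcal{Y}=\{1,\dots,K\}$, $K\ge2$. $X$ is a feature vector, $Y$ a class label, $D$ a random domain (which determines the distribution $P_{XY|D}$ of $(X,Y)$), and $M$ is metadata about the domain. Standing assumption: $(X,Y)$ and $M$ are conditionally independent given $D$, i.e. $P_{XY|D,M}=P_{XY|D}$. Versions of the conditional probabilities are fixed. $\mathbf{1}\{\cdot\}$ is the indicator of an event. Bayes classifiers: $f^*_{\mathrm{DI}}(x,m)=\arg\max_k \mathbb{P}(Y=k\mid X=x,M=m)$ and $f^*_{\mathrm{full}}(x,d)=\arg\max_k \mathbb{P}(Y=k\mid X=x,D=d)$ (any measurable choice of maximizer in case of ties). Bayes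 risks: $R^*_{\mathrm{DI}}=\mathbb{E}[\mathbf{1}\{f^*_{\mathrm{DI}}(X,M)\ne Y\}]=\mathbb{E}_{X,M}[1-\max_k\mathbb{P}(Y=k\mid X,M)]$ and $R^*_{\mathrm{full}}=\mathbb{E}[\mathbf{1}\{f^*_{\mathrm{full}}(X,D)\ne Y\}]=\mathbb{E}_{X,D}[1-\max_k\mathbb{P}(Y=k\mid X,D)]$. $\operatorname{2nd}\max_k$ returns the second largest value counted with multiplicity (so it equals the maximum if the maximum is attained by two or more labels). *)

theory Defs
  imports "HOL-Probability.Probability"
begin

text \<open>
  Random variables are measurable maps on one underlying probability space \<open>P\<close>. Their value
  spaces are arbitrary measurable spaces; labels live in \<open>count_space {1..K}\<close>.
\<close>

definition event_prob_given ::
    "'w measure \<Rightarrow> ('w \<Rightarrow> 'z) \<Rightarrow> 'z measure \<Rightarrow> 'w set \<Rightarrow> 'w \<Rightarrow> real" where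
  "event_prob_given P Z N E = real_cond_exp P (vimage_algebra (space P) Z N) (indicator E)"

text \<open>
  \<open>U\<close> and \<open>V\<close> are conditionally independent given \<open>W\<close>, in the form
  \<open>P(U \<in> A | W, V) = P(U \<in> A | W)\<close> almost surely, for every measurable \<open>A\<close>. No regular
  conditional distributions are presupposed.
\<close>

definition cond_indep_given ::
    "'w measure \<Rightarrow> ('w \<Rightarrow> 'u) \<Rightarrow> 'u measure \<Rightarrow> ('w \<Rightarrow> 'v) \<Rightarrow> 'v measure
      \<Rightarrow> ('w \<Rightarrow> 'z) \<Rightarrow> 'z measure \<Rightarrow> bool" where
  "cond_indep_given P U NU V NV W NW \<longleftrightarrow>
    (\<forall>A\<in>sets NU. AE \<omega> in P.
      event_prob_given P (\<lambda>\<omega>. (W \<omega>, V \<omega>)) (NW \<Otimes>\<^sub>M NV) (U -` A \<inter> space P) \<omega> =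
      event_prob_given P W NW (U -` A \<inter> space P) \<omega>)"

text \<open>
  \<open>p k z\<close> is a fixed version of \<open>P(Y = k | Z = z)\<close>. A version is only determined almost surely,
  so nothing is assumed about \<open>p\<close> on null sets beyond measurability.
\<close>

definition label_prob_version ::
    "'w measure \<Rightarrow> nat \<Rightarrow> ('w \<Rightarrow> nat) \<Rightarrow> ('w \<Rightarrow> 'z) \<Rightarrow> 'z measure \<Rightarrow> (nat \<Rightarrow> 'z \<Rightarrow> real) \<Rightarrow> bool" where
  "label_prob_version P K Y Z N p \<longleftrightarrow>
    (\<forall>k\<in>{1..K}. p k \<in> borel_measurable N \<and>
      (AE \<omega> in P. p k (Z \<omega>) = event_prob_given P Z N (Y -` {k} \<inter> space P) \<omega>))"

definition bayes_classifier ::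
    "nat \<Rightarrow> 'z measure \<Rightarrow> (nat \<Rightarrow> 'z \<Rightarrow> real) \<Rightarrow> ('z \<Rightarrow> nat) \<Rightarrow> bool" where
  "bayes_classifier K N p f \<longleftrightarrow>
    f \<in> measurable N (count_space {1..K}) \<and>
    (\<forall>z\<in>space N. is_arg_max (\<lambda>k. p k z) (\<lambda>k. k \<in> {1..K}) (f z))"

definition risk :: "'w measure \<Rightarrow> ('w \<Rightarrow> nat) \<Rightarrow> ('w \<Rightarrow> 'z) \<Rightarrow> ('z \<Rightarrow> nat) \<Rightarrow> real" where
  "risk P Y Z f = (\<integral>\<omega>. of_bool (f (Z \<omega>) \<noteq> Y \<omega>) \<partial>P)"

text \<open>
  Second largest of \<open>q 1, \<dots>, q K\<close> counted with multiplicity; meaningful for \<open>K \<ge> 2\<close>.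
\<close>

definition second_max :: "nat \<Rightarrow> (nat \<Rightarrow> real) \<Rightarrow> real" where
  "second_max K q = rev (sort (map q [1..<Suc K])) ! 1"

definition margin :: "nat \<Rightarrow> (nat \<Rightarrow> 'z \<Rightarrow> real) \<Rightarrow> 'z \<Rightarrow> real" where
  "margin K p z = Max ((\<lambda>k. p k z) ` {1..K}) - second_max K (\<lambda>k. p k z)"

end

theory Submission
  imports Defs "HOL-Combinatorics.List_Permutation"
begin

text \<open>
  By conditional independence \<open>P(Y = k | X, D, M) = P(Y = k | X, D)\<close>, so a classifier that
  sees \<open>(X, M)\<close> is correct with probability \<open>E[p(f(X, M) | X, D)]\<close>, where \<open>p(k | X, D)\<close> are the
  label probabilities of the full model. Hence the excess risk is the expectation of
  \<open>p(f_full | X, D) - p(f_DI | X, D)\<close>, which is nonnegative and at least the margin wherever the two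
  classifiers disagree. The upper bound holds pointwise: if only the classifier on \<open>(X, M)\<close> errs, then the
  two classifiers disagree.
\<close>

section \<open>Order statistics and the margin\<close>

text \<open>Sorting permutes positions injectively, so at most one of two distinct positions can
  land at index 0 of the descending list. The other lands at index 1 or later, where every entry is
  bounded by the entry at index 1.\<close>

lemma second_largest_ge_min:
  fixes xs :: "'a::linorder list"
  assumes ij: "i < length xs" "j < length xs" "i \<noteq> j"
  shows "min (xs ! i) (xs ! j) \<le> rev (sort xs) ! 1"
proof -
  let ?ys = "rev (sort xs)"
  have "mset xs = mset ?ys" by simp
  then obtain f where f: "bij_betw f {..<length xs} {..<length ?ys}"
    and nth: "\<forall>i<length xs. xs ! i = ?ys ! f i"
    using permutation_Ex_bij by blast
  have ne: "f i \<noteq> f j"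
    using f ij by (auto simp: bij_betw_def inj_on_def)
  have lt: "f i < length xs" "f j < length xs"
    using bij_betwE[OF f] ij by auto
  have le: "?ys ! a \<le> ?ys ! 1" if "1 \<le> a" "a < length xs" for a
    using sorted_rev_nth_mono[of ?ys 1 a] that by simp
  from ne have "1 \<le> f i \<or> 1 \<le> f j" by linarith
  then show ?thesis
    using le lt nth ij by (metis min.coboundedI1 min.coboundedI2)
qed

lemma second_max_ge:
  assumes "i \<in> {1..K}" "j \<in> {1..K}" "i \<noteq> j" "q j \<le> q i"
  shows "q j \<le> second_max K q"
proof -
  let ?xs = "map q [1..<Suc K]"
  \<comment> \<open>Labels start at 1 and list positions at 0, so label \<open>a\<close> sits at
    position \<open>a - 1\<close>.\<close>
  have nth: "?xs ! (a - 1) = q a" if "a \<in> {1..K}" for a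
    using that nth_upt[of 1 "a - 1" "Suc K"] by (auto simp del: upt_Suc)
  have "min (?xs ! (i - 1)) (?xs ! (j - 1)) \<le> second_max K q"
    unfolding second_max_def
    using assms(1-3) by (intro second_largest_ge_min) auto
  then show ?thesis using assms by (simp only: nth min_absorb2)
qed

text \<open>The maximum is attained at \<open>i\<close>, and any other label has a value at most the
  second largest. Counting with multiplicity covers ties: if \<open>j\<close> attains the maximum
  too, both sides are 0.\<close>

lemma margin_le_diff:
  assumes "is_arg_max (\<lambda>k. p k z) (\<lambda>k. k \<in> {1..K}) i" "j \<in> {1..K}" "i \<noteq> j"
  shows "margin K p z \<le> p i z - p j z"
proof -
  have i: "i \<in> {1..K}" and le: "\<And>k. k \<in> {1..K} \<Longrightarrow> p k z \<le> p i z"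
    using assms(1) by (auto simp: is_arg_max_linorder)
  have "Max ((\<lambda>k. p k z) ` {1..K}) = p i z"
    using i le by (intro Max_eqI) auto
  moreover have "p j z \<le> second_max K (\<lambda>k. p k z)"
    using second_max_ge[of i K j "\<lambda>k. p k z"] i le assms by auto
  ultimately show ?thesis by (simp add: margin_def)
qed

context prob_space
begin

section \<open>Conditional probabilities given a random variable\<close>

lemma finite_measure_subalgebra_vimage:
  assumes "Z \<in> M \<rightarrow>\<^sub>M N"
  shows "finite_measure_subalgebra M (vimage_algebra (space M) Z N)"
proof
  show "subalgebra M (vimage_algebra (space M) Z N)"
    using assms measurable_space[OF assms]
    by (auto simp: subalgebra_def sets_vimage_algebra2)
qed

lemma measurable_vimage_algebra_comp:
  assumes "Z \<in> M \<rightarrow>\<^sub>M N" "h \<in> N \<rightarrow>\<^sub>M L"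
  shows "(\<lambda>\<omega>. h (Z \<omega>)) \<in> vimage_algebra (space M) Z N \<rightarrow>\<^sub>M L"
  using measurable_space[OF assms(1)] assms(2)
  by (intro measurable_compose[OF measurable_vimage_algebra1]) auto

text \<open>This is the averaging property of conditional expectation. Under an integral with a
  weight measurable for the sigma-algebra of \<open>Z\<close>, an indicator and its conditional
  probability are interchangeable; later arguments use it in both directions.\<close>

lemma integrable_mult_event_prob_given:
  assumes "Z \<in> M \<rightarrow>\<^sub>M N" "E \<in> events"
    and "f \<in> borel_measurable (vimage_algebra (space M) Z N)" "integrable M f"
  shows "integrable M (\<lambda>\<omega>. f \<omega> * event_prob_given M Z N E \<omega>)"
    and "(\<integral>\<omega>. f \<omega> * event_prob_given M Z N E \<omega> \<partial>M) = (\<integral>\<omega>. f \<omega> * indicator E \<omega> \<partial>M)"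
proof -
  interpret F: finite_measure_subalgebra M "vimage_algebra (space M) Z N"
    by (rule finite_measure_subalgebra_vimage) fact
  have "integrable M (\<lambda>\<omega>. f \<omega> * indicator E \<omega>)"
    using assms by (intro integrable_real_mult_indicator)
  with assms show "integrable M (\<lambda>\<omega>. f \<omega> * event_prob_given M Z N E \<omega>)"
    and "(\<integral>\<omega>. f \<omega> * event_prob_given M Z N E \<omega> \<partial>M) = (\<integral>\<omega>. f \<omega> * indicator E \<omega> \<partial>M)"
    unfolding event_prob_given_def by (auto intro!: F.real_cond_exp_intg)
qed

lemma event_prob_given_measurable:
  "event_prob_given M Z N E \<in> borel_measurable (vimage_algebra (space M) Z N)"
  unfolding event_prob_given_def by (rule borel_measurable_cond_exp)

lemma event_prob_given_measurable' [measurable]: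
  "event_prob_given M Z N E \<in> borel_measurable M"
  unfolding event_prob_given_def by (rule borel_measurable_cond_exp2)

lemma integrable_event_prob_given:
  assumes "Z \<in> M \<rightarrow>\<^sub>M N" "E \<in> events"
  shows "integrable M (event_prob_given M Z N E)"
  using integrable_mult_event_prob_given(1)[OF assms borel_measurable_const integrable_const, of 1]
  unfolding mult_1 .

section \<open>Agreement of integrals on product events, and exchanging roles in conditional
  independence\<close>

text \<open>Dynkin's pi-lambda argument: measurable rectangles are closed under intersection and
  generate the product sigma-algebra, while the sets on which the two integrals agree are closed
  under complements and countable disjoint unions.\<close>

lemma set_integral_pair_eqI:
  fixes u v :: "'a \<Rightarrow> real"
  assumes [measurable]: "U \<in> M \<rightarrow>\<^sub>M N1" "V \<in> M \<rightarrow>\<^sub>M N2"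
    and int: "integrable M u" "integrable M v"
    and rect: "\<And>A B. A \<in> sets N1 \<Longrightarrow> B \<in> sets N2 \<Longrightarrow>
      (\<integral>\<omega>. indicator A (U \<omega>) * indicator B (V \<omega>) * u \<omega> \<partial>M) =
      (\<integral>\<omega>. indicator A (U \<omega>) * indicator B (V \<omega>) * v \<omega> \<partial>M)"
    and C: "C \<in> sets (N1 \<Otimes>\<^sub>M N2)"
  shows "(LINT \<omega>:(\<lambda>\<omega>. (U \<omega>, V \<omega>)) -` C \<inter> space M|M. u \<omega>) =
         (LINT \<omega>:(\<lambda>\<omega>. (U \<omega>, V \<omega>)) -` C \<inter> space M|M. v \<omega>)"
proof -
  let ?T = "\<lambda>C. (\<lambda>\<omega>. (U \<omega>, V \<omega>)) -` C \<inter> space M"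
  have UV: "(\<lambda>\<omega>. (U \<omega>, V \<omega>)) \<in> M \<rightarrow>\<^sub>M N1 \<Otimes>\<^sub>M N2" by measurable
  have meas: "?T C \<in> events" if "C \<in> sets (N1 \<Otimes>\<^sub>M N2)" for C
    by (rule measurable_sets[OF UV that])
  have sint: "set_integrable M S u" "set_integrable M S v" if "S \<in> events" for S
    unfolding set_integrable_def by (intro integrable_mult_indicator that int)+
  have space_in: "(U \<omega>, V \<omega>) \<in> space N1 \<times> space N2" if "\<omega> \<in> space M" for \<omega>
    using measurable_space[OF assms(1) that] measurable_space[OF assms(2) that] by blast
  have rect_eq: "(LINT \<omega>:?T (A \<times> B)|M. u \<omega>) = (LINT \<omega>:?T (A \<times> B)|M. v \<omega>)"
    if "A \<in> sets N1" "B \<in> sets N2" for A B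
  proof -
    have *: "(LINT \<omega>:?T (A \<times> B)|M. g \<omega>) =
          (\<integral>\<omega>. indicator A (U \<omega>) * indicator B (V \<omega>) * g \<omega> \<partial>M)" for g :: "'a \<Rightarrow> real"
      unfolding set_lebesgue_integral_def
      by (intro Bochner_Integration.integral_cong) (auto simp: indicator_def)
    show ?thesis unfolding * by (rule rect) fact+
  qed
  from Int_stable_pair_measure_generator pair_measure_closed C[unfolded sets_pair_measure]
  show ?thesis
  proof (induction rule: sigma_sets_induct_disjoint)
    case (basic A)
    then show ?case using rect_eq by auto
  next
    case empty
    then show ?case by (simp add: set_lebesgue_integral_def)
  next
    \<comment> \<open>The complement is relative to the full rectangle, whose preimage is all of
      \<open>space M\<close>. Additivity turns the integral over it into a difference of two
      integrals already known to agree.\<close>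
    case (compl A)
    let ?\<Omega> = "space N1 \<times> space N2"
    have A: "A \<in> sets (N1 \<Otimes>\<^sub>M N2)" using compl(1) by (simp add: sets_pair_measure)
    have eq: "?T (?\<Omega> - A) = space M - ?T A" and \<Omega>: "?T ?\<Omega> = space M"
      using space_in by auto
    have *: "(LINT \<omega>:?T (?\<Omega> - A)|M. g \<omega>) = (LINT \<omega>:?T ?\<Omega>|M. g \<omega>) - (LINT \<omega>:?T A|M. g \<omega>)"
      if "integrable M g" for g :: "'a \<Rightarrow> real"
    proof -
      have s: "set_integrable M S g" if "S \<in> events" for S
        unfolding set_integrable_def
        by (rule integrable_mult_indicator[OF that \<open>integrable M g\<close>])
      have "(LINT \<omega>:(space M - ?T A) \<union> ?T A|M. g \<omega>)
          = (LINT \<omega>:(space M - ?T A)|M. g \<omega>) + (LINT \<omega>:?T A|M. g \<omega>)"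
        using meas[OF A] by (intro set_integral_Un s) auto
      moreover have "(space M - ?T A) \<union> ?T A = space M" by auto
      ultimately show ?thesis unfolding eq \<Omega> by simp
    qed
    show ?case
      unfolding *[OF int(1)] *[OF int(2)] compl(2) by (simp only: rect_eq sets.top)
  next
    case (union A)
    have m: "?T (A i) \<in> events" for i
      using union(2) by (intro meas) (auto simp: sets_pair_measure)
    have eq: "?T (\<Union>i. A i) = (\<Union>i. ?T (A i))" by auto
    have disj: "?T (A i) \<inter> ?T (A j) = {}" if "i \<noteq> j" for i j
      using union(1) that by (auto simp: disjoint_family_on_def)
    have U: "(\<Union>i. ?T (A i)) \<in> events" using m by blast
    have "(LINT \<omega>:(\<Union>i. ?T (A i))|M. u \<omega>) = (\<Sum>i. LINT \<omega>:?T (A i)|M. u \<omega>)"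
      by (rule lebesgue_integral_countable_add[OF m disj sint(1)[OF U]])
    moreover have "(LINT \<omega>:(\<Union>i. ?T (A i))|M. v \<omega>) = (\<Sum>i. LINT \<omega>:?T (A i)|M. v \<omega>)"
      by (rule lebesgue_integral_countable_add[OF m disj sint(2)[OF U]])
    ultimately show ?case
      unfolding eq by (simp only: union(3))
  qed
qed

text \<open>
  Conditional independence is assumed as \<open>P(U \<in> A | W, V) = P(U \<in> A | W)\<close>; this is the
  version with \<open>U\<close> and \<open>V\<close> exchanged, which allows integrands that depend on all of \<open>(U, W)\<close>.
\<close>

lemma cond_indep_given_swap:
  assumes ci: "cond_indep_given M U NU V NV W NW"
    and meas [measurable]: "U \<in> M \<rightarrow>\<^sub>M NU" "V \<in> M \<rightarrow>\<^sub>M NV" "W \<in> M \<rightarrow>\<^sub>M NW"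
    and B [measurable]: "B \<in> sets NV"
  shows "AE \<omega> in M. event_prob_given M (\<lambda>\<omega>. (U \<omega>, W \<omega>)) (NU \<Otimes>\<^sub>M NW) (V -` B \<inter> space M) \<omega> =
    event_prob_given M W NW (V -` B \<inter> space M) \<omega>"
proof -
  let ?F = "vimage_algebra (space M) (\<lambda>\<omega>. (U \<omega>, W \<omega>)) (NU \<Otimes>\<^sub>M NW)"
  let ?EB = "V -` B \<inter> space M"
  let ?g = "event_prob_given M W NW ?EB"
  have UW: "(\<lambda>\<omega>. (U \<omega>, W \<omega>)) \<in> M \<rightarrow>\<^sub>M NU \<Otimes>\<^sub>M NW"
    and WV: "(\<lambda>\<omega>. (W \<omega>, V \<omega>)) \<in> M \<rightarrow>\<^sub>M NW \<Otimes>\<^sub>M NV" by measurable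
  interpret F: finite_measure_subalgebra M ?F
    by (rule finite_measure_subalgebra_vimage[OF UW])
  have EB: "?EB \<in> events" by measurable
  \<comment> \<open>Both sides equal E[1_C(W) P(U in A | W) P(V in B | W)]. From the left, the
    weight 1_C(W) 1_B(V) allows conditioning on (W, V), which the hypothesis reduces to W; then the
    indicator of \<open>?EB\<close> is averaged to \<open>?g\<close>. Finally \<open>?a\<close> is
    traded back for the indicator of \<open>?EA\<close>, now with the weight 1_C(W)
    \<open>?g\<close>.\<close>
  have rect: "(\<integral>\<omega>. indicator A (U \<omega>) * indicator C (W \<omega>) * indicator ?EB \<omega> \<partial>M) =
      (\<integral>\<omega>. indicator A (U \<omega>) * indicator C (W \<omega>) * ?g \<omega> \<partial>M)"
    if A [measurable]: "A \<in> sets NU" and C [measurable]: "C \<in> sets NW" for A C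
  proof -
    let ?EA = "U -` A \<inter> space M"
    let ?a = "event_prob_given M W NW ?EA"
    let ?FWV = "vimage_algebra (space M) (\<lambda>\<omega>. (W \<omega>, V \<omega>)) (NW \<Otimes>\<^sub>M NV)"
    let ?FW = "vimage_algebra (space M) W NW"
    have EA: "?EA \<in> events" by measurable
    let ?cb = "\<lambda>\<omega>. indicator (C \<times> B) (W \<omega>, V \<omega>) :: real"
    let ?c = "\<lambda>\<omega>. indicator C (W \<omega>) :: real"
    have cb: "?cb \<in> borel_measurable ?FWV"
      using measurable_vimage_algebra_comp[OF WV, of "indicator (C \<times> B)" borel] by simp
    have c: "?c \<in> borel_measurable ?FW"
      using measurable_vimage_algebra_comp[OF meas(3), of "indicator C" borel] by simp
    have c_int: "integrable M ?c" and cb_int: "integrable M ?cb"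
      by (auto intro!: integrable_const_bound[where B=1])
    have ca_int: "integrable M (\<lambda>\<omega>. ?c \<omega> * ?a \<omega>)" and cg_int: "integrable M (\<lambda>\<omega>. ?c \<omega> * ?g \<omega>)"
      using integrable_mult_event_prob_given(1)[OF meas(3) _ c c_int] EA EB by auto
    have "(\<integral>\<omega>. indicator A (U \<omega>) * indicator C (W \<omega>) * indicator ?EB \<omega> \<partial>M) =
      (\<integral>\<omega>. ?cb \<omega> * indicator ?EA \<omega> \<partial>M)"
      by (intro Bochner_Integration.integral_cong) (auto simp: indicator_def)
    also have "\<dots> = (\<integral>\<omega>. ?cb \<omega> * event_prob_given M (\<lambda>\<omega>. (W \<omega>, V \<omega>)) (NW \<Otimes>\<^sub>M NV) ?EA \<omega> \<partial>M)"
      using integrable_mult_event_prob_given(2)[OF WV EA cb cb_int] by simp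
    also have "\<dots> = (\<integral>\<omega>. ?cb \<omega> * ?a \<omega> \<partial>M)"
    proof (rule integral_cong_AE)
      show "AE \<omega> in M. ?cb \<omega> * event_prob_given M (\<lambda>\<omega>. (W \<omega>, V \<omega>)) (NW \<Otimes>\<^sub>M NV) ?EA \<omega> = ?cb \<omega> * ?a \<omega>"
        using ci A unfolding cond_indep_given_def by force
    qed measurable
    also have "\<dots> = (\<integral>\<omega>. (?c \<omega> * ?a \<omega>) * indicator ?EB \<omega> \<partial>M)"
      by (intro Bochner_Integration.integral_cong) (auto simp: indicator_def)
    also have "\<dots> = (\<integral>\<omega>. (?c \<omega> * ?a \<omega>) * ?g \<omega> \<partial>M)"
      using integrable_mult_event_prob_given(2)[OF meas(3) EB borel_measurable_times[OF c event_prob_given_measurable] ca_int]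
      by simp
    also have "\<dots> = (\<integral>\<omega>. (?c \<omega> * ?g \<omega>) * ?a \<omega> \<partial>M)" by (simp add: ac_simps)
    also have "\<dots> = (\<integral>\<omega>. (?c \<omega> * ?g \<omega>) * indicator ?EA \<omega> \<partial>M)"
      by (rule integrable_mult_event_prob_given(2)[OF meas(3) EA borel_measurable_times[OF c event_prob_given_measurable] cg_int])
    also have "\<dots> = (\<integral>\<omega>. indicator A (U \<omega>) * indicator C (W \<omega>) * ?g \<omega> \<partial>M)"
      by (intro Bochner_Integration.integral_cong) (auto simp: indicator_def)
    finally show ?thesis .
  qed
  \<comment> \<open>Only the conditional probability given (U, W) is unfolded. \<open>?g\<close>
    stays as the candidate, identified by its integrals over events of sigma(U, W) and its
    measurability there.\<close>
  show ?thesis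
    unfolding event_prob_given_def[of M "\<lambda>\<omega>. (U \<omega>, W \<omega>)"]
  proof (rule F.real_cond_exp_charact)
    show int: "integrable M (indicator ?EB :: _ \<Rightarrow> real)" "integrable M ?g"
      using integrable_event_prob_given[OF meas(3) EB] EB by (auto simp: integrable_indicator_iff emeasure_eq_measure)
    fix S assume "S \<in> sets ?F"
    have "(\<lambda>\<omega>. (U \<omega>, W \<omega>)) \<in> space M \<rightarrow> space (NU \<Otimes>\<^sub>M NW)"
      by (intro funcsetI measurable_space[OF UW])
    then have "sets ?F = {(\<lambda>\<omega>. (U \<omega>, W \<omega>)) -` C \<inter> space M |C. C \<in> sets (NU \<Otimes>\<^sub>M NW)}"
      by (rule sets_vimage_algebra2)
    with \<open>S \<in> sets ?F\<close> obtain C where C: "S = (\<lambda>\<omega>. (U \<omega>, W \<omega>)) -` C \<inter> space M" "C \<in> sets (NU \<Otimes>\<^sub>M NW)"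
      by (simp only: mem_Collect_eq) (elim exE conjE, rule that)
    show "(LINT \<omega>:S|M. indicator ?EB \<omega>) = (LINT \<omega>:S|M. ?g \<omega>)"
      unfolding C(1) by (rule set_integral_pair_eqI[OF meas(1,3) int rect C(2)])
  next
    \<comment> \<open>W is a function of (U, W), so the identity is measurable from sigma(U, W) to
      sigma(W). This lifts the measurability of \<open>?g\<close> to the larger
      sigma-algebra.\<close>
    have "W \<in> ?F \<rightarrow>\<^sub>M NW"
      using measurable_vimage_algebra_comp[OF UW measurable_snd] by simp
    then have "(\<lambda>\<omega>. \<omega>) \<in> ?F \<rightarrow>\<^sub>M vimage_algebra (space M) W NW"
      by (intro measurable_vimage_algebra2) auto
    from measurable_compose[OF this event_prob_given_measurable]
    show "?g \<in> borel_measurable ?F" .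
  qed
qed

section \<open>Misclassification probabilities in terms of label probabilities\<close>

text \<open>With finitely many labels, agreement of two label-valued maps is a finite union of
  intersections of preimages. Disagreement is therefore an event.\<close>

lemma integrable_of_bool_neq:
  assumes a: "a \<in> M \<rightarrow>\<^sub>M count_space S" and b: "b \<in> M \<rightarrow>\<^sub>M count_space S" and "finite S"
  shows "integrable M (\<lambda>\<omega>. of_bool (a \<omega> \<noteq> b \<omega>) :: real)"
proof -
  let ?N = "space M - (\<Union>k\<in>S. (a -` {k} \<inter> space M) \<inter> (b -` {k} \<inter> space M))"
  have "?N \<in> events"
    using \<open>finite S\<close>
    by (intro sets.Diff sets.top sets.finite_UN sets.Int measurable_sets[OF a] measurable_sets[OF b]) auto
  then have "integrable M (indicator ?N :: _ \<Rightarrow> real)"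
    by (simp add: integrable_indicator_iff emeasure_eq_measure)
  also have "?this \<longleftrightarrow> ?thesis"
    using measurable_space[OF a]
    by (intro Bochner_Integration.integrable_cong refl) (auto simp: indicator_def)
  finally show ?thesis .
qed

text \<open>Split by the predicted label: P(g = Y) is the sum over k of P(g = k, Y = k), and each
  term is the integral of \<open>q k\<close> over {g = k}. Since \<open>q\<close> is tied to
  \<open>g\<close> only through these events, the label probabilities of the full model can serve
  for either classifier.\<close>

lemma expectation_mismatch_eq:
  fixes q :: "nat \<Rightarrow> 'a \<Rightarrow> real"
  assumes g [measurable]: "g \<in> M \<rightarrow>\<^sub>M count_space {1..K}" and Y [measurable]: "Y \<in> M \<rightarrow>\<^sub>M count_space {1..K}"
    and int: "\<And>k. k \<in> {1..K} \<Longrightarrow> integrable M (q k)"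
    and eq: "\<And>k. k \<in> {1..K} \<Longrightarrow> (LINT \<omega>:g -` {k} \<inter> space M|M. indicator (Y -` {k} \<inter> space M) \<omega>) =
      (LINT \<omega>:g -` {k} \<inter> space M|M. q k \<omega>)"
  shows "integrable M (\<lambda>\<omega>. q (g \<omega>) \<omega>)"
    and "(\<integral>\<omega>. of_bool (g \<omega> \<noteq> Y \<omega>) \<partial>M) = 1 - (\<integral>\<omega>. q (g \<omega>) \<omega> \<partial>M)"
proof -
  let ?I = "\<lambda>k. indicator (g -` {k} \<inter> space M) :: 'a \<Rightarrow> real"
  let ?J = "\<lambda>k. indicator (Y -` {k} \<inter> space M) :: 'a \<Rightarrow> real"
  have range: "g \<omega> \<in> {1..K}" "Y \<omega> \<in> {1..K}" if "\<omega> \<in> space M" for \<omega>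
    using measurable_space[OF g that] measurable_space[OF Y that] by auto
  have ev: "g -` {k} \<inter> space M \<in> events" "Y -` {k} \<inter> space M \<in> events" if "k \<in> {1..K}" for k
    using that by (auto intro: measurable_sets[OF g] measurable_sets[OF Y])
  have sum_eq: "(\<Sum>k\<in>{1..K}. ?I k \<omega> * r k) = r (g \<omega>)" if "\<omega> \<in> space M" for \<omega> and r :: "nat \<Rightarrow> real"
  proof -
    have "(\<Sum>k\<in>{1..K}. ?I k \<omega> * r k) = (\<Sum>k\<in>{1..K}. if g \<omega> = k then r k else 0)"
      using that by (intro sum.cong) (auto simp: indicator_def)
    also have "\<dots> = r (g \<omega>)" using range(1)[OF that] by simp
    finally show ?thesis .
  qed
  have intI: "integrable M (\<lambda>\<omega>. ?I k \<omega> * q k \<omega>)" if "k \<in> {1..K}" for k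
    using integrable_mult_indicator[OF ev(1) int, OF that that] by simp
  have intJ: "integrable M (\<lambda>\<omega>. ?I k \<omega> * ?J k \<omega>)" if "k \<in> {1..K}" for k
    using ev[OF that] by (intro integrable_const_bound[where B=1]) (auto simp: indicator_def)
  have "integrable M (\<lambda>\<omega>. \<Sum>k\<in>{1..K}. ?I k \<omega> * q k \<omega>)"
    using intI by (rule Bochner_Integration.integrable_sum)
  then show "integrable M (\<lambda>\<omega>. q (g \<omega>) \<omega>)"
    by (subst Bochner_Integration.integrable_cong[OF refl sum_eq[symmetric]]) auto
  \<comment> \<open>\<open>sum_eq\<close> with the values \<open>?J k\<close> collapses the sum to
    the indicator of Y = g.\<close>
  have mismatch: "of_bool (g \<omega> \<noteq> Y \<omega>) = 1 - (\<Sum>k\<in>{1..K}. ?I k \<omega> * ?J k \<omega>)"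
    if "\<omega> \<in> space M" for \<omega>
    unfolding sum_eq[OF that] using that by (auto simp: indicator_def)
  have "(\<integral>\<omega>. of_bool (g \<omega> \<noteq> Y \<omega>) \<partial>M) = (\<integral>\<omega>. 1 - (\<Sum>k\<in>{1..K}. ?I k \<omega> * ?J k \<omega>) \<partial>M)"
    by (intro Bochner_Integration.integral_cong refl mismatch)
  also have "\<dots> = 1 - (\<integral>\<omega>. (\<Sum>k\<in>{1..K}. ?I k \<omega> * ?J k \<omega>) \<partial>M)"
    by (subst Bochner_Integration.integral_diff[OF integrable_const Bochner_Integration.integrable_sum[OF intJ]])
      (simp_all only: lebesgue_integral_const prob_space scaleR_one)
  also have "(\<integral>\<omega>. (\<Sum>k\<in>{1..K}. ?I k \<omega> * ?J k \<omega>) \<partial>M) = (\<Sum>k\<in>{1..K}. \<integral>\<omega>. ?I k \<omega> * ?J k \<omega> \<partial>M)"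
    using intJ by (rule Bochner_Integration.integral_sum)
  also have "(\<Sum>k\<in>{1..K}. \<integral>\<omega>. ?I k \<omega> * ?J k \<omega> \<partial>M) = (\<Sum>k\<in>{1..K}. \<integral>\<omega>. ?I k \<omega> * q k \<omega> \<partial>M)"
    using eq by (intro sum.cong) (auto simp: set_lebesgue_integral_def)
  also have "\<dots> = (\<integral>\<omega>. (\<Sum>k\<in>{1..K}. ?I k \<omega> * q k \<omega>) \<partial>M)"
    using intI by (rule Bochner_Integration.integral_sum[symmetric])
  also have "\<dots> = (\<integral>\<omega>. q (g \<omega>) \<omega> \<partial>M)"
    by (intro Bochner_Integration.integral_cong refl sum_eq)
  finally show "(\<integral>\<omega>. of_bool (g \<omega> \<noteq> Y \<omega>) \<partial>M) = 1 - (\<integral>\<omega>. q (g \<omega>) \<omega> \<partial>M)" .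
qed

text \<open>The averaging property passes from the conditional probability to the fixed version
  \<open>p\<close>, because the two integrands agree almost everywhere.\<close>

lemma label_prob_version_integral:
  assumes Z: "Z \<in> M \<rightarrow>\<^sub>M N" and Y: "Y \<in> M \<rightarrow>\<^sub>M count_space {1..K}"
    and p: "label_prob_version M K Y Z N p" and k: "k \<in> {1..K}"
  shows "integrable M (\<lambda>\<omega>. p k (Z \<omega>))"
    and "f \<in> borel_measurable (vimage_algebra (space M) Z N) \<Longrightarrow> integrable M f \<Longrightarrow>
      integrable M (\<lambda>\<omega>. f \<omega> * p k (Z \<omega>)) \<and>
      (\<integral>\<omega>. f \<omega> * p k (Z \<omega>) \<partial>M) = (\<integral>\<omega>. f \<omega> * indicator (Y -` {k} \<inter> space M) \<omega> \<partial>M)"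
proof -
  let ?E = "Y -` {k} \<inter> space M" and ?F = "vimage_algebra (space M) Z N"
  have E: "?E \<in> events" using measurable_sets[OF Y] k by simp
  have "p k \<in> borel_measurable N"
    and ae: "AE \<omega> in M. p k (Z \<omega>) = event_prob_given M Z N ?E \<omega>"
    using p k by (auto simp: label_prob_version_def)
  then have pm [measurable]: "(\<lambda>\<omega>. p k (Z \<omega>)) \<in> borel_measurable M"
    using Z by measurable
  have *: "integrable M (\<lambda>\<omega>. f \<omega> * p k (Z \<omega>)) \<and>
      (\<integral>\<omega>. f \<omega> * p k (Z \<omega>) \<partial>M) = (\<integral>\<omega>. f \<omega> * indicator ?E \<omega> \<partial>M)"
    if f: "f \<in> borel_measurable ?F" "integrable M f" for f
  proof -
    have [measurable]: "f \<in> borel_measurable M" using f(2) by (rule borel_measurable_integrable)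
    have ae': "AE \<omega> in M. f \<omega> * event_prob_given M Z N ?E \<omega> = f \<omega> * p k (Z \<omega>)"
      using ae by eventually_elim simp
    have "(\<lambda>\<omega>. f \<omega> * p k (Z \<omega>)) \<in> borel_measurable M" by measurable
    then have "integrable M (\<lambda>\<omega>. f \<omega> * p k (Z \<omega>))"
      by (rule integrable_cong_AE_imp[OF integrable_mult_event_prob_given(1)[OF Z E f] _ ae'])
    moreover have "(\<integral>\<omega>. f \<omega> * p k (Z \<omega>) \<partial>M) = (\<integral>\<omega>. f \<omega> * event_prob_given M Z N ?E \<omega> \<partial>M)"
    proof (rule integral_cong_AE)
      show "AE \<omega> in M. f \<omega> * p k (Z \<omega>) = f \<omega> * event_prob_given M Z N ?E \<omega>"
        using ae' by eventually_elim (rule sym)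
    qed measurable
    ultimately show ?thesis
      by (simp only: integrable_mult_event_prob_given(2)[OF Z E f] simp_thms)
  qed
  \<comment> \<open>The weight is the constant 1.\<close>
  from *[OF borel_measurable_const integrable_const, of 1]
  show "integrable M (\<lambda>\<omega>. p k (Z \<omega>))" by (simp only: mult_1)
  show "f \<in> borel_measurable ?F \<Longrightarrow> integrable M f \<Longrightarrow>
      integrable M (\<lambda>\<omega>. f \<omega> * p k (Z \<omega>)) \<and>
      (\<integral>\<omega>. f \<omega> * p k (Z \<omega>) \<partial>M) = (\<integral>\<omega>. f \<omega> * indicator ?E \<omega> \<partial>M)"
    by (rule *)
qed

text \<open>
  Given \<open>D\<close>, the metadata \<open>V\<close> carry no information on \<open>(X, Y)\<close>, so the label probabilities
  given \<open>(X, D)\<close> also serve as label probabilities on events of \<open>\<sigma>(X, V)\<close>.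
\<close>

lemma set_integral_label_prob_metadata:
  assumes X [measurable]: "X \<in> M \<rightarrow>\<^sub>M MX" and Y [measurable]: "Y \<in> M \<rightarrow>\<^sub>M count_space {1..K}"
    and V [measurable]: "V \<in> M \<rightarrow>\<^sub>M MV" and D [measurable]: "D \<in> M \<rightarrow>\<^sub>M MD"
    and ci: "cond_indep_given M (\<lambda>\<omega>. (X \<omega>, Y \<omega>)) (MX \<Otimes>\<^sub>M count_space {1..K}) V MV D MD"
    and p: "label_prob_version M K Y (\<lambda>\<omega>. (X \<omega>, D \<omega>)) (MX \<Otimes>\<^sub>M MD) p"
    and k: "k \<in> {1..K}" and C: "C \<in> sets (MX \<Otimes>\<^sub>M MV)"
  shows "(LINT \<omega>:(\<lambda>\<omega>. (X \<omega>, V \<omega>)) -` C \<inter> space M|M. indicator (Y -` {k} \<inter> space M) \<omega>) =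
    (LINT \<omega>:(\<lambda>\<omega>. (X \<omega>, V \<omega>)) -` C \<inter> space M|M. p k (X \<omega>, D \<omega>))"
proof (rule set_integral_pair_eqI[OF X V _ _ _ C])
  let ?E = "Y -` {k} \<inter> space M"
  let ?NXY = "MX \<Otimes>\<^sub>M count_space {1..K}"
  let ?FXD = "vimage_algebra (space M) (\<lambda>\<omega>. (X \<omega>, D \<omega>)) (MX \<Otimes>\<^sub>M MD)"
  let ?G = "vimage_algebra (space M) (\<lambda>\<omega>. ((X \<omega>, Y \<omega>), D \<omega>)) (?NXY \<Otimes>\<^sub>M MD)"
  have XD: "(\<lambda>\<omega>. (X \<omega>, D \<omega>)) \<in> M \<rightarrow>\<^sub>M MX \<Otimes>\<^sub>M MD"
    and XY: "(\<lambda>\<omega>. (X \<omega>, Y \<omega>)) \<in> M \<rightarrow>\<^sub>M ?NXY"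
    and XYD: "(\<lambda>\<omega>. ((X \<omega>, Y \<omega>), D \<omega>)) \<in> M \<rightarrow>\<^sub>M ?NXY \<Otimes>\<^sub>M MD" by measurable
  have E [measurable]: "?E \<in> events" using measurable_sets[OF Y] k by simp
  show "integrable M (indicator ?E :: _ \<Rightarrow> real)"
    using E by (simp add: integrable_indicator_iff emeasure_eq_measure)
  show p_int: "integrable M (\<lambda>\<omega>. p k (X \<omega>, D \<omega>))"
    by (rule label_prob_version_integral(1)[OF XD Y p k])
  have pk [measurable]: "p k \<in> borel_measurable (MX \<Otimes>\<^sub>M MD)"
    using p k by (auto simp: label_prob_version_def)
  fix A B assume A [measurable]: "A \<in> sets MX" and B [measurable]: "B \<in> sets MV"
  let ?EB = "V -` B \<inter> space M"
  let ?g = "event_prob_given M D MD ?EB"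
  let ?a = "\<lambda>\<omega>. indicator A (X \<omega>) :: real"
  have EB: "?EB \<in> events" by measurable
  have aMX: "(\<lambda>\<omega>. indicator A (fst (fst \<omega>)) :: real) \<in> borel_measurable (?NXY \<Otimes>\<^sub>M MD)"
    and aXD: "(\<lambda>\<omega>. indicator A (fst \<omega>) :: real) \<in> borel_measurable (MX \<Otimes>\<^sub>M MD)"
    by measurable
  \<comment> \<open>By the exchanged form of conditional independence, P(V in B | X, Y, D) = P(V in
    B | D). So next to any integrable function of (X, Y, D) the indicator of \<open>?EB\<close> may
    be replaced by \<open>?g\<close>.\<close>
  have swap: "(\<integral>\<omega>. h \<omega> * indicator ?EB \<omega> \<partial>M) = (\<integral>\<omega>. h \<omega> * ?g \<omega> \<partial>M)"
    if "h \<in> borel_measurable ?G" "integrable M h" for h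
  proof -
    have [measurable]: "h \<in> borel_measurable M" using that(2) by (rule borel_measurable_integrable)
    have "(\<integral>\<omega>. h \<omega> * indicator ?EB \<omega> \<partial>M) =
      (\<integral>\<omega>. h \<omega> * event_prob_given M (\<lambda>\<omega>. ((X \<omega>, Y \<omega>), D \<omega>)) (?NXY \<Otimes>\<^sub>M MD) ?EB \<omega> \<partial>M)"
      using integrable_mult_event_prob_given(2)[OF XYD EB that] by simp
    also have "\<dots> = (\<integral>\<omega>. h \<omega> * ?g \<omega> \<partial>M)"
      using cond_indep_given_swap[OF ci XY V D B] by (intro integral_cong_AE) auto
    finally show ?thesis .
  qed
  have "(indicator {k} :: nat \<Rightarrow> real) \<in> borel_measurable (count_space {1..K})" by simp
  from measurable_compose[OF measurable_compose[OF measurable_fst measurable_snd] this]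
  have "(\<lambda>z. indicator A (fst (fst z)) * indicator {k} (snd (fst z)) :: real) \<in> borel_measurable (?NXY \<Otimes>\<^sub>M MD)"
    by (rule borel_measurable_times[OF aMX])
  from measurable_vimage_algebra_comp[OF XYD this]
  have "(\<lambda>\<omega>. ?a \<omega> * indicator {k} (Y \<omega>)) \<in> borel_measurable ?G" by simp
  also have "?this \<longleftrightarrow> (\<lambda>\<omega>. ?a \<omega> * indicator ?E \<omega>) \<in> borel_measurable ?G"
    by (intro measurable_cong) (auto simp: indicator_def)
  finally have h1: "(\<lambda>\<omega>. ?a \<omega> * indicator ?E \<omega>) \<in> borel_measurable ?G" .
  have h1i: "integrable M (\<lambda>\<omega>. ?a \<omega> * indicator ?E \<omega>)"
    by (intro integrable_const_bound[where B=1]) (auto simp: indicator_def)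
  have "(\<lambda>z. indicator A (fst (fst z)) * p k (fst (fst z), snd z)) \<in> borel_measurable (?NXY \<Otimes>\<^sub>M MD)"
    by measurable
  from measurable_vimage_algebra_comp[OF XYD this]
  have h2: "(\<lambda>\<omega>. ?a \<omega> * p k (X \<omega>, D \<omega>)) \<in> borel_measurable ?G" by simp
  have h2i: "integrable M (\<lambda>\<omega>. ?a \<omega> * p k (X \<omega>, D \<omega>))"
    by (rule Bochner_Integration.integrable_bound[OF p_int]) (auto simp: indicator_def)
  \<comment> \<open>As before, sigma(D) is contained in sigma(X, D).\<close>
  have gXD: "?g \<in> borel_measurable ?FXD"
  proof -
    have "D \<in> ?FXD \<rightarrow>\<^sub>M MD"
      using measurable_vimage_algebra_comp[OF XD measurable_snd] by simp
    then have "(\<lambda>\<omega>. \<omega>) \<in> ?FXD \<rightarrow>\<^sub>M vimage_algebra (space M) D MD"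
      by (intro measurable_vimage_algebra2) auto
    from measurable_compose[OF this event_prob_given_measurable] show ?thesis .
  qed
  have ag: "(\<lambda>\<omega>. ?a \<omega> * ?g \<omega>) \<in> borel_measurable ?FXD"
    using measurable_vimage_algebra_comp[OF XD aXD] gXD by simp
  have agi: "integrable M (\<lambda>\<omega>. ?a \<omega> * ?g \<omega>)"
    by (rule Bochner_Integration.integrable_bound[OF integrable_event_prob_given[OF D EB]])
      (auto simp: indicator_def)
  \<comment> \<open>The indicator of \<open>?EB\<close> blocks averaging over Y given (X, D), since
    it depends on V. It is first traded for \<open>?g\<close>, a function of D; then the indicator
    of \<open>?E\<close> becomes \<open>p k\<close>, and \<open>?g\<close> is traded back.\<close>
  have "(\<integral>\<omega>. ?a \<omega> * indicator B (V \<omega>) * indicator ?E \<omega> \<partial>M) =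
    (\<integral>\<omega>. (?a \<omega> * indicator ?E \<omega>) * indicator ?EB \<omega> \<partial>M)"
    by (intro Bochner_Integration.integral_cong) (auto simp: indicator_def)
  also have "\<dots> = (\<integral>\<omega>. (?a \<omega> * ?g \<omega>) * indicator ?E \<omega> \<partial>M)"
    unfolding swap[OF h1 h1i] by (simp add: ac_simps)
  also have "\<dots> = (\<integral>\<omega>. (?a \<omega> * ?g \<omega>) * p k (X \<omega>, D \<omega>) \<partial>M)"
    using label_prob_version_integral(2)[OF XD Y p k ag agi] by simp
  also have "\<dots> = (\<integral>\<omega>. (?a \<omega> * p k (X \<omega>, D \<omega>)) * ?g \<omega> \<partial>M)"
    by (simp add: ac_simps)
  also have "\<dots> = (\<integral>\<omega>. (?a \<omega> * p k (X \<omega>, D \<omega>)) * indicator ?EB \<omega> \<partial>M)"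
    using swap[OF h2 h2i] by simp
  also have "\<dots> = (\<integral>\<omega>. ?a \<omega> * indicator B (V \<omega>) * p k (X \<omega>, D \<omega>) \<partial>M)"
    by (intro Bochner_Integration.integral_cong) (auto simp: indicator_def)
  finally show "(\<integral>\<omega>. ?a \<omega> * indicator B (V \<omega>) * indicator ?E \<omega> \<partial>M) =
    (\<integral>\<omega>. ?a \<omega> * indicator B (V \<omega>) * p k (X \<omega>, D \<omega>) \<partial>M)" .
qed

end

theorem theorem3:
  fixes P :: "'w measure"
    and MX :: "'x measure" and MM :: "'m measure" and MD :: "'d measure"
    and X :: "'w \<Rightarrow> 'x" and Y :: "'w \<Rightarrow> nat" and M :: "'w \<Rightarrow> 'm" and D :: "'w \<Rightarrow> 'd"
    and K :: nat
    and p_DI :: "nat \<Rightarrow> 'x \<times> 'm \<Rightarrow> real" and p_full :: "nat \<Rightarrow> 'x \<times> 'd \<Rightarrow> real"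
    and f_DI :: "'x \<times> 'm \<Rightarrow> nat" and f_full :: "'x \<times> 'd \<Rightarrow> nat"
  assumes "prob_space P"
    and "K \<ge> 2"
    and "X \<in> measurable P MX"
    and "Y \<in> measurable P (count_space {1..K})"
    and "M \<in> measurable P MM"
    and "D \<in> measurable P MD"
    and "cond_indep_given P (\<lambda>\<omega>. (X \<omega>, Y \<omega>)) (MX \<Otimes>\<^sub>M count_space {1..K}) M MM D MD"
    and "label_prob_version P K Y (\<lambda>\<omega>. (X \<omega>, M \<omega>)) (MX \<Otimes>\<^sub>M MM) p_DI"
    and "label_prob_version P K Y (\<lambda>\<omega>. (X \<omega>, D \<omega>)) (MX \<Otimes>\<^sub>M MD) p_full"
    and "bayes_classifier K (MX \<Otimes>\<^sub>M MM) p_DI f_DI"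
    and "bayes_classifier K (MX \<Otimes>\<^sub>M MD) p_full f_full"
  shows "(\<integral>\<omega>. margin K p_full (X \<omega>, D \<omega>) * of_bool (f_full (X \<omega>, D \<omega>) \<noteq> f_DI (X \<omega>, M \<omega>)) \<partial>P)
           \<le> risk P Y (\<lambda>\<omega>. (X \<omega>, M \<omega>)) f_DI - risk P Y (\<lambda>\<omega>. (X \<omega>, D \<omega>)) f_full
         \<and> risk P Y (\<lambda>\<omega>. (X \<omega>, M \<omega>)) f_DI - risk P Y (\<lambda>\<omega>. (X \<omega>, D \<omega>)) f_full
           \<le> (\<integral>\<omega>. of_bool (f_full (X \<omega>, D \<omega>) \<noteq> f_DI (X \<omega>, M \<omega>)) \<partial>P)"
proof -
  interpret prob_space P by fact
  note X [measurable] = assms(3) and Y [measurable] = assms(4)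
    and M [measurable] = assms(5) and D [measurable] = assms(6)
  note p = assms(9)
  let ?XM = "\<lambda>\<omega>. (X \<omega>, M \<omega>)" and ?XD = "\<lambda>\<omega>. (X \<omega>, D \<omega>)"
  let ?g = "\<lambda>\<omega>. f_DI (?XM \<omega>)" and ?h = "\<lambda>\<omega>. f_full (?XD \<omega>)"
  let ?q = "\<lambda>k \<omega>. p_full k (?XD \<omega>)"
  have f [measurable]: "f_DI \<in> MX \<Otimes>\<^sub>M MM \<rightarrow>\<^sub>M count_space {1..K}"
      "f_full \<in> MX \<Otimes>\<^sub>M MD \<rightarrow>\<^sub>M count_space {1..K}"
    using assms(10,11) by (auto simp: bayes_classifier_def)
  have XM: "?XM \<in> P \<rightarrow>\<^sub>M MX \<Otimes>\<^sub>M MM" and XD: "?XD \<in> P \<rightarrow>\<^sub>M MX \<Otimes>\<^sub>M MD"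
    and g [measurable]: "?g \<in> P \<rightarrow>\<^sub>M count_space {1..K}"
    and h [measurable]: "?h \<in> P \<rightarrow>\<^sub>M count_space {1..K}" by measurable
  note q_int = label_prob_version_integral(1)[OF XD Y p]
  \<comment> \<open>The event that \<open>f_DI\<close> predicts k lies in sigma(X, M), so the
    metadata lemma applies with the label probabilities \<open>p_full\<close>.\<close>
  have g_eq: "(LINT \<omega>:?g -` {k} \<inter> space P|P. indicator (Y -` {k} \<inter> space P) \<omega>) =
      (LINT \<omega>:?g -` {k} \<inter> space P|P. ?q k \<omega>)" if k: "k \<in> {1..K}" for k
  proof -
    have "f_DI -` {k} \<inter> space (MX \<Otimes>\<^sub>M MM) \<in> sets (MX \<Otimes>\<^sub>M MM)"
      using measurable_sets[OF f(1)] k by simp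
    note set_integral_label_prob_metadata[OF X Y M D assms(7) p k this]
    moreover have "?XM -` (f_DI -` {k} \<inter> space (MX \<Otimes>\<^sub>M MM)) \<inter> space P = ?g -` {k} \<inter> space P"
      using measurable_space[OF XM] by auto
    ultimately show ?thesis by simp
  qed
  \<comment> \<open>Here the event already lies in sigma(X, D), and the averaging property of
    \<open>p_full\<close> suffices.\<close>
  have h_eq: "(LINT \<omega>:?h -` {k} \<inter> space P|P. indicator (Y -` {k} \<inter> space P) \<omega>) =
      (LINT \<omega>:?h -` {k} \<inter> space P|P. ?q k \<omega>)" if k: "k \<in> {1..K}" for k
  proof -
    let ?F = "vimage_algebra (space P) ?XD (MX \<Otimes>\<^sub>M MD)"
    have "?h -` {k} \<inter> space ?F \<in> sets ?F"
      using measurable_sets[OF measurable_vimage_algebra_comp[OF XD f(2)]] k by simp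
    then have "(indicator (?h -` {k} \<inter> space P) :: _ \<Rightarrow> real) \<in> borel_measurable ?F"
      by (simp add: borel_measurable_indicator)
    moreover have "integrable P (indicator (?h -` {k} \<inter> space P) :: _ \<Rightarrow> real)"
      using measurable_sets[OF h] k by (simp add: integrable_indicator_iff emeasure_eq_measure)
    ultimately show ?thesis
      using label_prob_version_integral(2)[OF XD Y p k] by (simp add: set_lebesgue_integral_def)
  qed
  note g_risk = expectation_mismatch_eq[OF g Y q_int g_eq]
  note h_risk = expectation_mismatch_eq[OF h Y q_int h_eq]
  \<comment> \<open>Both risks are now 1 minus an expectation of the same \<open>p_full\<close>,
    evaluated at the respective predictions.\<close>
  have risk_diff: "risk P Y ?XM f_DI - risk P Y ?XD f_full = (\<integral>\<omega>. ?q (?h \<omega>) \<omega> - ?q (?g \<omega>) \<omega> \<partial>P)"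
    using g_risk h_risk by (simp add: risk_def)
  have "(\<integral>\<omega>. margin K p_full (?XD \<omega>) * of_bool (?h \<omega> \<noteq> ?g \<omega>) \<partial>P)
      \<le> (\<integral>\<omega>. ?q (?h \<omega>) \<omega> - ?q (?g \<omega>) \<omega> \<partial>P)"
  \<comment> \<open>This form of monotonicity asks for integrability of the larger function only. If
    the margin term were not integrable, its integral would be 0 by convention, which is where
    nonnegativity of the larger function enters.\<close>
  proof (rule integral_mono')
    show "integrable P (\<lambda>\<omega>. ?q (?h \<omega>) \<omega> - ?q (?g \<omega>) \<omega>)"
      using g_risk(1) h_risk(1) by (rule Bochner_Integration.integrable_diff[rotated])
    fix \<omega> assume \<omega>: "\<omega> \<in> space P"
    have g_range: "?g \<omega> \<in> {1..K}" using measurable_space[OF g \<omega>] by simp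
    have am: "is_arg_max (\<lambda>k. p_full k (?XD \<omega>)) (\<lambda>k. k \<in> {1..K}) (?h \<omega>)"
      using assms(11) measurable_space[OF XD \<omega>] by (auto simp: bayes_classifier_def)
    show "0 \<le> ?q (?h \<omega>) \<omega> - ?q (?g \<omega>) \<omega>"
      using am g_range by (auto simp: is_arg_max_linorder)
    then show "margin K p_full (?XD \<omega>) * of_bool (?h \<omega> \<noteq> ?g \<omega>) \<le> ?q (?h \<omega>) \<omega> - ?q (?g \<omega>) \<omega>"
      using margin_le_diff[where p = p_full and z = "?XD \<omega>", OF am g_range] by (cases "?h \<omega> = ?g \<omega>") auto
  qed
  moreover have "risk P Y ?XM f_DI - risk P Y ?XD f_full \<le> (\<integral>\<omega>. of_bool (?h \<omega> \<noteq> ?g \<omega>) \<partial>P)"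
  proof -
    note bint = integrable_of_bool_neq[OF _ _ finite_atLeastAtMost]
    have "risk P Y ?XM f_DI - risk P Y ?XD f_full =
        (\<integral>\<omega>. of_bool (?g \<omega> \<noteq> Y \<omega>) - of_bool (?h \<omega> \<noteq> Y \<omega>) \<partial>P)"
      unfolding risk_def using bint[OF g Y] bint[OF h Y] by simp
    also have "\<dots> \<le> (\<integral>\<omega>. of_bool (?h \<omega> \<noteq> ?g \<omega>) \<partial>P)"
      using bint[OF g Y] bint[OF h Y] bint[OF h g]
      by (intro integral_mono Bochner_Integration.integrable_diff) auto
    finally show ?thesis .
  qed
  ultimately show ?thesis unfolding risk_diff by simp
qed

end
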